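(* Let $p,q\in\mathbb{N}$ (positive integers), $p-1<\alpha<p$. The time fractional PDE $$D_t^\alpha u-D_x^q K([u]_x)=0,\qquad u=u(x,t),\quad (x,t)\in(a,b)\times(t_0,T),$$ with $D_t^\alpha={}^{\mathrm{RL}}D_t^\alpha$ the Riemann-Liouville fractional derivative, has at least $p\cdot q$ conservation laws, given by $D_x(F)+D_t(G)$ with $$F=\sum_{\ell=0}^k(-1)^{\ell+1}\frac{k!}{(k-\ell)!}\,x^{k-\ell}D_x^{q-1-\ell}\big(\rho(t)K([u]_x)\big),\qquad G=x^k\bar G,\qquad k=0,\ldots,q-1,$$ where $$\rho(t)=t^j,\qquad \bar G=\sum_{i=0}^j(-1)^i\frac{j!}{(j-i)!}\,t^{j-i}D_t^{p-i-1}\big(I_t^{p-\alpha}u\big),\qquad j=0,\ldots,p-1.$$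
   Context: The symbol $[u]_x$ denotes $u$ and its integer-order derivatives in space; $[u]_\alpha$ denotes $u$, its fractional and integer derivatives and its fractional integrals. $D_x,D_t$ are total derivatives. The Riemann-Liouville derivative is ${}^{\mathrm{RL}}D_t^\alpha f=D_t^p(I_t^{p-\alpha}f)$, where $$I_t^{p-\alpha}f=\frac1{\Gamma(p-\alpha)}\int_{t_0}^t\frac{f(x,\tau)}{(t-\tau)^{1-p+\alpha}}\,d\tau .$$ A conservation law of the PDE is a total divergence $D_x(F(x,t,[u]_\alpha))+D_t(G(x,t,[u]_\alpha))$ that vanishes on solutions of the PDE; $F$ is called the flux and $G$ the density. It is assumed that $G$ depends on fractional integrals of order $p-\alpha$ only. All functions are understood to be regular enough for the expressions to make sense. *)

theory Defs
  imports "HOL-Analysis.Analysis"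
begin

text \<open>
  Functions of space and time are curried, \<open>w x t\<close>. A function that the mathematics regards as
  given on \<open>(a,b) \<times> (t0,T)\<close> is a total function, and its values outside this set play no role.
  Expressions in \<open>u\<close> and its derivatives and fractional integrals are operators on such functions;
  total derivatives act on an operator by differentiating the function it returns.
\<close>

type_synonym xtfun = "real \<Rightarrow> real \<Rightarrow> real"

definition Dx :: "xtfun \<Rightarrow> xtfun" where
  "Dx w = (\<lambda>x t. deriv (\<lambda>y. w y t) x)"

definition Dt :: "xtfun \<Rightarrow> xtfun" where
  "Dt w = (\<lambda>x t. deriv (\<lambda>s. w x s) t)"

definition frac_int :: "real \<Rightarrow> real \<Rightarrow> xtfun \<Rightarrow> xtfun" where
  "frac_int t0 s w =
    (\<lambda>x t. 1 / Gamma s * (LBINT \<tau>:{t0<..<t}. w x \<tau> / (t - \<tau>) powr (1 - s)))"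

text \<open>The Riemann-Liouville derivative of order \<open>\<alpha>\<close>, intended for \<open>p - 1 < \<alpha> < p\<close>.\<close>

definition RL_deriv :: "real \<Rightarrow> nat \<Rightarrow> real \<Rightarrow> xtfun \<Rightarrow> xtfun" where
  "RL_deriv t0 p \<alpha> w = (Dt ^^ p) (frac_int t0 (real p - \<alpha>) w)"

text \<open>\<open>K([u]\<^sub>x)\<close>, where \<open>K\<close> is a function of \<open>u\<close> and its space derivatives up to order \<open>r\<close>;
  only the values of \<open>K\<close> on lists of length \<open>r + 1\<close> matter.\<close>

definition space_fun :: "(real list \<Rightarrow> real) \<Rightarrow> nat \<Rightarrow> xtfun \<Rightarrow> xtfun" where
  "space_fun K r u = (\<lambda>x t. K (map (\<lambda>m. (Dx ^^ m) u x t) [0..<Suc r]))"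

text \<open>Existence of every derivative and integral that occurs in the equation.\<close>

definition regular ::
  "real \<Rightarrow> real \<Rightarrow> real \<Rightarrow> real \<Rightarrow> nat \<Rightarrow> nat \<Rightarrow> real \<Rightarrow> (real list \<Rightarrow> real) \<Rightarrow> nat \<Rightarrow> xtfun set" where
  "regular a b t0 T p q \<alpha> K r = {u. \<forall>x\<in>{a<..<b}. \<forall>t\<in>{t0<..<T}.
      (\<forall>m<r. (\<lambda>y. (Dx ^^ m) u y t) differentiable (at x)) \<and>
      (\<forall>m<q. (\<lambda>y. (Dx ^^ m) (space_fun K r u) y t) differentiable (at x)) \<and>
      set_integrable lborel {t0<..<t} (\<lambda>\<tau>. u x \<tau> / (t - \<tau>) powr (1 - (real p - \<alpha>))) \<and>
      (\<forall>m<p. (\<lambda>s. (Dt ^^ m) (frac_int t0 (real p - \<alpha>) u) x s) differentiable (at t))}"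

definition PDE_lhs ::
  "real \<Rightarrow> nat \<Rightarrow> nat \<Rightarrow> real \<Rightarrow> (real list \<Rightarrow> real) \<Rightarrow> nat \<Rightarrow> xtfun \<Rightarrow> xtfun" where
  "PDE_lhs t0 p q \<alpha> K r u = (\<lambda>x t. RL_deriv t0 p \<alpha> u x t - (Dx ^^ q) (space_fun K r u) x t)"

text \<open>
  Functions of \<open>x, t, [u]\<^sub>\<alpha>\<close> in which only fractional integrals whose order lies in \<open>S\<close> occur.
  Fractional derivatives are integer derivatives of fractional integrals. Closure under total
  derivatives makes differentiability hypotheses on \<open>\<phi>\<close> unnecessary: for smooth \<open>\<phi>\<close>, the total
  derivative of \<open>\<phi>(\<dots>)\<close> is by the chain rule again a function of the same kind.
\<close>

inductive frac_diff_fun :: "real \<Rightarrow> real set \<Rightarrow> (xtfun \<Rightarrow> xtfun) \<Rightarrow> bool"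
  for t0 :: real and S :: "real set" where
  explicit: "frac_diff_fun t0 S (\<lambda>u. f)"
| dep_var: "frac_diff_fun t0 S (\<lambda>u. u)"
| integral: "s \<in> S \<Longrightarrow> frac_diff_fun t0 S (frac_int t0 s)"
| deriv_x: "frac_diff_fun t0 S E \<Longrightarrow> frac_diff_fun t0 S (\<lambda>u. Dx (E u))"
| deriv_t: "frac_diff_fun t0 S E \<Longrightarrow> frac_diff_fun t0 S (\<lambda>u. Dt (E u))"
| compose: "(\<And>E. E \<in> set Es \<Longrightarrow> frac_diff_fun t0 S E) \<Longrightarrow>
    frac_diff_fun t0 S (\<lambda>u x t. \<phi> (map (\<lambda>E. E u x t) Es))"

definition total_div :: "(xtfun \<Rightarrow> xtfun) \<Rightarrow> (xtfun \<Rightarrow> xtfun) \<Rightarrow> xtfun \<Rightarrow> xtfun" where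
  "total_div F G u = (\<lambda>x t. Dx (F u) x t + Dt (G u) x t)"

text \<open>
  Conservation laws, with flux \<open>F\<close> and density \<open>G\<close>, of the equation \<open>E u = 0\<close> on \<open>X \<times> J\<close> for
  unknowns \<open>u \<in> U\<close>. The density may contain only fractional integrals of order \<open>s\<close>.
\<close>

definition conservation_law ::
  "real set \<Rightarrow> real set \<Rightarrow> real \<Rightarrow> real \<Rightarrow> xtfun set \<Rightarrow> (xtfun \<Rightarrow> xtfun) \<Rightarrow>
   (xtfun \<Rightarrow> xtfun) \<Rightarrow> (xtfun \<Rightarrow> xtfun) \<Rightarrow> bool" where
  "conservation_law X J t0 s U E F G \<longleftrightarrow>
    frac_diff_fun t0 {0<..} F \<and> frac_diff_fun t0 {s} G \<and>
    (\<forall>u\<in>U. \<forall>x\<in>X. \<forall>t\<in>J.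
      (\<lambda>y. F u y t) differentiable (at x) \<and> (\<lambda>\<tau>. G u x \<tau>) differentiable (at t)) \<and>
    (\<forall>u\<in>U. (\<forall>x\<in>X. \<forall>t\<in>J. E u x t = 0) \<longrightarrow> (\<forall>x\<in>X. \<forall>t\<in>J. total_div F G u x t = 0))"

text \<open>Linear independence over the reals of a family of operators, regarded as maps from \<open>U\<close> to
  functions on \<open>X \<times> J\<close>.\<close>

definition lin_indep_ops ::
  "real set \<Rightarrow> real set \<Rightarrow> xtfun set \<Rightarrow> 'i set \<Rightarrow> ('i \<Rightarrow> xtfun \<Rightarrow> xtfun) \<Rightarrow> bool" where
  "lin_indep_ops X J U I P \<longleftrightarrow>
    (\<forall>c. (\<forall>u\<in>U. \<forall>x\<in>X. \<forall>t\<in>J. (\<Sum>i\<in>I. c i * P i u x t) = 0) \<longrightarrow> (\<forall>i\<in>I. c i = 0))"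

definition cl_flux ::
  "nat \<Rightarrow> (real list \<Rightarrow> real) \<Rightarrow> nat \<Rightarrow> nat \<Rightarrow> (real \<Rightarrow> real) \<Rightarrow> xtfun \<Rightarrow> xtfun" where
  "cl_flux q K r k \<rho> u = (\<lambda>x t. \<Sum>l=0..k. (-1) ^ (l + 1) * (fact k / fact (k - l)) * x ^ (k - l) *
      (Dx ^^ (q - 1 - l)) (\<lambda>y s. \<rho> s * space_fun K r u y s) x t)"

definition cl_density_bar :: "real \<Rightarrow> nat \<Rightarrow> real \<Rightarrow> nat \<Rightarrow> xtfun \<Rightarrow> xtfun" where
  "cl_density_bar t0 p \<alpha> j u = (\<lambda>x t. \<Sum>i=0..j. (-1) ^ i * (fact j / fact (j - i)) * t ^ (j - i) *
      (Dt ^^ (p - i - 1)) (frac_int t0 (real p - \<alpha>) u) x t)"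

definition cl_density :: "real \<Rightarrow> nat \<Rightarrow> real \<Rightarrow> nat \<Rightarrow> nat \<Rightarrow> xtfun \<Rightarrow> xtfun" where
  "cl_density t0 p \<alpha> k j u = (\<lambda>x t. x ^ k * cl_density_bar t0 p \<alpha> j u x t)"

end

theory Submission
  imports Defs
begin

text \<open>
  Integrating \<open>x\<^sup>k D\<^sub>x\<^sup>q\<close> and \<open>t\<^sup>j D\<^sub>t\<^sup>p\<close> by parts telescopes, so the divergence of \<open>(F, G)\<close> is the
  left-hand side of the equation times \<open>x\<^sup>k t\<^sup>j\<close>. At \<open>u = 1\<close> the flux term of the equation vanishes,
  for any \<open>K\<close>, and the fractional derivative is a nonzero multiple of \<open>(t - t0)\<close> to the power \<open>- \<alpha>\<close>.
  A vanishing linear combination of the divergences is thus a polynomial in \<open>x\<close> and \<open>t\<close> that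
  vanishes on a rectangle.
\<close>

section \<open>The divergence as a multiple of the equation\<close>

text \<open>Repeated integration by parts, with \<open>d m\<close> in the role of the m-th
  derivative of a function. It serves the flux, as a function of x, and the density, as a function
  of t.\<close>

lemma telescoping_derivative:
  fixes d :: "nat \<Rightarrow> real \<Rightarrow> real"
  assumes "k < n" and d: "\<And>m. m < n \<Longrightarrow> (d m has_real_derivative d (Suc m) x) (at x)"
  shows "((\<lambda>y. \<Sum>l=0..k. (-1) ^ l * (fact k / fact (k - l)) * y ^ (k - l) * d (n - 1 - l) y)
          has_real_derivative x ^ k * d n x) (at x)"
proof -
  \<comment> \<open>The product rule gives \<open>h l\<close>, where \<open>d\<close> is
    differentiated, and \<open>- h (Suc l)\<close>, where the power is. The cutoff covers l = k,
    whose power is constant: truncated subtraction would otherwise leave a spurious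
    \<open>h (Suc k)\<close>.\<close>
  define h where "h l = (if l \<le> k then (-1) ^ l * (fact k / fact (k - l)) * x ^ (k - l) * d (n - l) x else 0)"
    for l
  have "((\<lambda>y. (-1) ^ l * (fact k / fact (k - l)) * y ^ (k - l) * d (n - 1 - l) y)
          has_real_derivative h l - h (Suc l)) (at x)" if "l \<le> k" for l
  proof -
    have "Suc (n - 1 - l) = n - l"
      using that \<open>k < n\<close> by simp
    then have D: "(d (n - Suc l) has_real_derivative d (n - l) x) (at x)"
      using d[of "n - 1 - l"] \<open>k < n\<close> by simp
    have h': "h (Suc l) = - ((-1) ^ l * (fact k / fact (k - l)) * (real (k - l) * x ^ (k - l - 1))) * d (n - 1 - l) x"
    proof (cases "l = k")
      case False
      then have "l < k"
        using that by simp
      then obtain i where "k = Suc (l + i)"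
        using less_imp_Suc_add by blast
      then show ?thesis
        by (simp add: h_def fact_Suc field_simps del: of_nat_Suc)
    qed (simp add: h_def)
    show ?thesis
      unfolding h' using that
      by (auto intro!: derivative_eq_intros D simp: h_def add_divide_distrib distrib_left mult_ac)
  qed
  then have "((\<lambda>y. \<Sum>l=0..k. (-1) ^ l * (fact k / fact (k - l)) * y ^ (k - l) * d (n - 1 - l) y)
          has_real_derivative (\<Sum>l=0..k. h l - h (Suc l))) (at x)"
    by (intro DERIV_sum) auto
  also have "(\<Sum>l=0..k. h l - h (Suc l)) = h 0 - h (Suc k)"
    by (simp only: atLeast0AtMost sum_telescope)
  also have "\<dots> = x ^ k * d n x"
    by (simp add: h_def)
  finally show ?thesis .
qed

lemma Dx_pow_Suc: "(Dx ^^ Suc m) w x t = deriv (\<lambda>y. (Dx ^^ m) w y t) x"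
  by (simp only: funpow.simps comp_apply) (simp only: Dx_def)

lemma Dt_pow_Suc: "(Dt ^^ Suc m) w x t = deriv (\<lambda>s. (Dt ^^ m) w x s) t"
  by (simp only: funpow.simps comp_apply) (simp only: Dt_def)

text \<open>The factor \<open>\<rho> t\<close> is constant in space. Equality at a single point
  would not determine the next derivative, so the induction runs over all points of the open
  set.\<close>

lemma Dx_pow_mult_left:
  assumes "open X" and diff: "\<And>m y. m < n \<Longrightarrow> y \<in> X \<Longrightarrow> (\<lambda>z. (Dx ^^ m) w z t) differentiable (at y)"
    and "m \<le> n" "x \<in> X"
  shows "(Dx ^^ m) (\<lambda>y s. \<rho> s * w y s) x t = \<rho> t * (Dx ^^ m) w x t"
  using \<open>m \<le> n\<close> \<open>x \<in> X\<close>
proof (induction m arbitrary: x)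
  case (Suc m)
  have "((\<lambda>y. (Dx ^^ m) w y t) has_real_derivative (Dx ^^ Suc m) w x t) (at x)"
    using diff[of m x] Suc.prems by (simp add: Dx_pow_Suc DERIV_deriv_iff_real_differentiable del: funpow.simps)
  then have "((\<lambda>y. \<rho> t * (Dx ^^ m) w y t) has_real_derivative \<rho> t * (Dx ^^ Suc m) w x t) (at x)"
    by (rule DERIV_cmult)
  then have "((\<lambda>y. (Dx ^^ m) (\<lambda>y s. \<rho> s * w y s) y t) has_real_derivative \<rho> t * (Dx ^^ Suc m) w x t) (at x)"
    by (rule has_field_derivative_transform_within_open[OF _ \<open>open X\<close>]) (use Suc in auto)
  then show ?case
    unfolding Dx_pow_Suc by (rule DERIV_imp_deriv)
qed simp

text \<open>Telescoping with n = q for the space derivatives of \<open>\<rho>\<close> times K. The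
  exponent l + 1 of -1 in the flux supplies the minus sign that the space term has in the
  equation.\<close>

lemma cl_flux_derivative:
  assumes u: "u \<in> regular a b t0 T p q \<alpha> K r" and "k < q" and x: "x \<in> {a<..<b}" and t: "t \<in> {t0<..<T}"
  shows "((\<lambda>y. cl_flux q K r k \<rho> u y t) has_real_derivative
           - (x ^ k * (\<rho> t * (Dx ^^ q) (space_fun K r u) x t))) (at x)"
proof -
  define d where "d m y = (Dx ^^ m) (\<lambda>y s. \<rho> s * space_fun K r u y s) y t" for m y
  have diff: "(\<lambda>z. (Dx ^^ m) (space_fun K r u) z t) differentiable (at y)"
    if "m < q" "y \<in> {a<..<b}" for m y
    using u t that unfolding regular_def by blast
  have d_eq: "d m y = \<rho> t * (Dx ^^ m) (space_fun K r u) y t" if "m \<le> q" "y \<in> {a<..<b}" for m y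
    unfolding d_def by (rule Dx_pow_mult_left[where X = "{a<..<b}"]) (use diff that in auto)
  have "(d m has_real_derivative d (Suc m) x) (at x)" if "m < q" for m
  proof -
    have "((\<lambda>y. (Dx ^^ m) (space_fun K r u) y t) has_real_derivative
            (Dx ^^ Suc m) (space_fun K r u) x t) (at x)"
      using diff[OF that x] by (simp add: Dx_pow_Suc DERIV_deriv_iff_real_differentiable del: funpow.simps)
    from DERIV_cmult[OF this, of "\<rho> t"]
    have "((\<lambda>y. \<rho> t * (Dx ^^ m) (space_fun K r u) y t) has_real_derivative d (Suc m) x) (at x)"
      using that x by (simp only: d_eq Suc_leI)
    \<comment> \<open>The two functions are known to agree only on (a,b), an open neighbourhood of
      x, which suffices for their derivatives at x.\<close>
    then show ?thesis
      by (rule has_field_derivative_transform_within_open[of _ _ _ "{a<..<b}"])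
        (use that x d_eq in auto)
  qed
  from DERIV_minus[OF telescoping_derivative[where d = d, OF \<open>k < q\<close> this]]
  show ?thesis
    using d_eq[OF order_refl x] by (simp add: cl_flux_def sum_negf flip: d_def)
qed

text \<open>Telescoping with n = p for the time derivatives of the fractional integral, the p-th of
  which is the Riemann-Liouville derivative; \<open>x ^ k\<close> is constant in time.\<close>

lemma cl_density_derivative:
  assumes u: "u \<in> regular a b t0 T p q \<alpha> K r" and "j < p" and x: "x \<in> {a<..<b}" and t: "t \<in> {t0<..<T}"
  shows "((\<lambda>s. cl_density t0 p \<alpha> k j u x s) has_real_derivative
           x ^ k * (t ^ j * RL_deriv t0 p \<alpha> u x t)) (at t)"
proof -
  define d where "d m s = (Dt ^^ m) (frac_int t0 (real p - \<alpha>) u) x s" for m s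
  have "(d m has_real_derivative d (Suc m) t) (at t)" if "m < p" for m
  proof -
    have "(\<lambda>s. (Dt ^^ m) (frac_int t0 (real p - \<alpha>) u) x s) differentiable (at t)"
      using u x t that unfolding regular_def by blast
    then show ?thesis
      by (simp add: d_def[abs_def] Dt_pow_Suc DERIV_deriv_iff_real_differentiable del: funpow.simps)
  qed
  from DERIV_cmult[OF telescoping_derivative[where d = d, OF \<open>j < p\<close> this], of "x ^ k"]
  show ?thesis
    by (simp add: cl_density_def cl_density_bar_def RL_deriv_def d_def[abs_def] diff_right_commute)
qed

text \<open>The multiplier is \<open>x ^ k * t ^ j\<close>. Since u ranges over all regular
  functions, solutions or not, this yields both the conservation laws and, at u = 1, their
  independence.\<close>

lemma total_div_eq:
  assumes "u \<in> regular a b t0 T p q \<alpha> K r" "k < q" "j < p" "x \<in> {a<..<b}" "t \<in> {t0<..<T}"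
  shows "total_div (cl_flux q K r k (\<lambda>t. t ^ j)) (cl_density t0 p \<alpha> k j) u x t
           = x ^ k * t ^ j * PDE_lhs t0 p q \<alpha> K r u x t"
  using DERIV_imp_deriv[OF cl_flux_derivative[OF assms(1,2,4,5), where \<rho> = "\<lambda>t. t ^ j"]]
    DERIV_imp_deriv[OF cl_density_derivative[OF assms(1,3,4,5), where k = k]]
  by (simp add: total_div_def Dx_def Dt_def PDE_lhs_def algebra_simps)

lemma frac_diff_fun_add:
  assumes "frac_diff_fun t0 S E" "frac_diff_fun t0 S E'"
  shows "frac_diff_fun t0 S (\<lambda>u x t. E u x t + E' u x t)"
  using frac_diff_fun.compose[of "[E, E']" t0 S "\<lambda>vs. vs ! 0 + vs ! 1"] assms by auto

lemma frac_diff_fun_mult: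
  assumes "frac_diff_fun t0 S E" "frac_diff_fun t0 S E'"
  shows "frac_diff_fun t0 S (\<lambda>u x t. E u x t * E' u x t)"
  using frac_diff_fun.compose[of "[E, E']" t0 S "\<lambda>vs. vs ! 0 * vs ! 1"] assms by auto

lemma frac_diff_fun_sum:
  assumes "finite I" "\<And>i. i \<in> I \<Longrightarrow> frac_diff_fun t0 S (E i)"
  shows "frac_diff_fun t0 S (\<lambda>u x t. \<Sum>i\<in>I. E i u x t)"
  using assms
  by (induction I rule: finite_induct) (auto intro: frac_diff_fun.explicit frac_diff_fun_add)

lemma frac_diff_fun_Dx_pow:
  "frac_diff_fun t0 S E \<Longrightarrow> frac_diff_fun t0 S (\<lambda>u. (Dx ^^ n) (E u))"
  by (induction n) (auto intro: frac_diff_fun.deriv_x)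

lemma frac_diff_fun_Dt_pow:
  "frac_diff_fun t0 S E \<Longrightarrow> frac_diff_fun t0 S (\<lambda>u. (Dt ^^ n) (E u))"
  by (induction n) (auto intro: frac_diff_fun.deriv_t)

lemma frac_diff_fun_space_fun: "frac_diff_fun t0 S (space_fun K r)"
proof -
  have "frac_diff_fun t0 S
      (\<lambda>u x t. K (map (\<lambda>E. E u x t) (map (\<lambda>m u. (Dx ^^ m) u) [0..<Suc r])))"
    by (rule frac_diff_fun.compose)
      (auto intro: frac_diff_fun_Dx_pow frac_diff_fun.dep_var simp del: upt_Suc)
  then show ?thesis
    by (simp add: space_fun_def[abs_def] comp_def del: upt_Suc)
qed

text \<open>The flux contains no fractional integral, so \<open>S\<close> is arbitrary.\<close>

lemma frac_diff_fun_cl_flux: "frac_diff_fun t0 S (cl_flux q K r k \<rho>)"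
  unfolding cl_flux_def[abs_def]
  by (intro frac_diff_fun_sum frac_diff_fun_mult frac_diff_fun_Dx_pow frac_diff_fun_space_fun
      frac_diff_fun.explicit finite_atLeastAtMost)

lemma frac_diff_fun_cl_density: "frac_diff_fun t0 {real p - \<alpha>} (cl_density t0 p \<alpha> k j)"
  unfolding cl_density_def[abs_def] cl_density_bar_def[abs_def]
  by (intro frac_diff_fun_sum frac_diff_fun_mult frac_diff_fun_Dt_pow frac_diff_fun.integral
      frac_diff_fun.explicit finite_atLeastAtMost singletonI)

section \<open>The equation at u = 1\<close>

text \<open>For s < 1 the kernel is singular at the upper end, but its primitive is continuous there
  because s > 0. The fundamental theorem for nonnegative integrands needs only one-sided limits of
  the primitive and gives integrability as well.\<close>

lemma Abel_kernel_integral: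
  fixes s t t0 :: real
  assumes "s > 0" "t0 < t"
  shows "set_integrable lborel {t0<..<t} (\<lambda>\<tau>. 1 / (t - \<tau>) powr (1 - s))"
    and "(LBINT \<tau>:{t0<..<t}. 1 / (t - \<tau>) powr (1 - s)) = (t - t0) powr s / s"
proof -
  define F where "F \<tau> = - ((t - \<tau>) powr s) / s" for \<tau>
  have *: "(F has_real_derivative 1 / (t - \<tau>) powr (1 - s)) (at \<tau>)" if "\<tau> < t" for \<tau>
  proof -
    have "(t - \<tau>) powr (s - 1) = 1 / (t - \<tau>) powr (1 - s)"
      by (metis minus_diff_eq powr_minus_divide)
    then show ?thesis
      unfolding F_def using that assms by (auto intro!: derivative_eq_intros)
  qed
  have F_cont: "continuous_on {..t} F"
    unfolding F_def using \<open>s > 0\<close> by (intro continuous_intros continuous_on_powr') auto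
  have lim: "((F \<circ> real_of_ereal) \<longlongrightarrow> F t0) (at_right (ereal t0))"
       "((F \<circ> real_of_ereal) \<longlongrightarrow> F t) (at_left (ereal t))"
    using DERIV_isCont[OF *[OF \<open>t0 < t\<close>]] F_cont unfolding ereal_tendsto_simps
    by (auto simp: continuous_on_def isCont_def intro: tendsto_within_subset)
  have cont: "isCont (\<lambda>\<tau>. 1 / (t - \<tau>) powr (1 - s)) \<tau>" if "\<tau> < t" for \<tau>
    using that by (auto intro!: continuous_intros)
  note FTC = interval_integral_FTC_nonneg[of "ereal t0" "ereal t" F _ "F t0" "F t", OF _ _ _ _ lim]
  show "set_integrable lborel {t0<..<t} (\<lambda>\<tau>. 1 / (t - \<tau>) powr (1 - s))"
    using FTC(1)[of "\<lambda>\<tau>. 1 / (t - \<tau>) powr (1 - s)"] * cont \<open>t0 < t\<close>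
    by (simp add: AE_I2)
  have "(LBINT \<tau>=ereal t0..ereal t. 1 / (t - \<tau>) powr (1 - s)) = F t - F t0"
    by (rule FTC(2)) (use * cont \<open>t0 < t\<close> in \<open>simp_all add: AE_I2\<close>)
  then show "(LBINT \<tau>:{t0<..<t}. 1 / (t - \<tau>) powr (1 - s)) = (t - t0) powr s / s"
    using assms by (simp add: F_def interval_lebesgue_integral_def)
qed

lemma frac_int_one:
  assumes "s > 0" "t0 < t"
  shows "frac_int t0 s (\<lambda>x t. 1) x t = (t - t0) powr s / (s * Gamma s)"
  unfolding frac_int_def Abel_kernel_integral(2)[OF assms] by simp

text \<open>Each derivative lowers the exponent by one and contributes one factor of the falling
  factorial of s.\<close>

lemma Dt_pow_shifted_powr:
  assumes w: "\<And>t. t0 < t \<Longrightarrow> w x t = c * (t - t0) powr s" and "t0 < t"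
  shows "(Dt ^^ m) w x t = c * (\<Prod>i<m. s - real i) * (t - t0) powr (s - real m)"
    and "(\<lambda>t. (Dt ^^ m) w x t) differentiable (at t)"
proof -
  \<comment> \<open>One differentiation, conditional on the formula at level m, since it is used
    both in the induction and for the differentiability claim.\<close>
  have deriv: "((\<lambda>t. (Dt ^^ m) w x t) has_real_derivative
      c * (\<Prod>i<Suc m. s - real i) * (t - t0) powr (s - real (Suc m))) (at t)"
    if "\<And>t. t0 < t \<Longrightarrow> (Dt ^^ m) w x t = c * (\<Prod>i<m. s - real i) * (t - t0) powr (s - real m)" "t0 < t"
    for m t
  proof (rule has_field_derivative_transform_within_open[of _ _ _ "{t0<..}"])
    show "((\<lambda>t. c * (\<Prod>i<m. s - real i) * (t - t0) powr (s - real m)) has_real_derivative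
      c * (\<Prod>i<Suc m. s - real i) * (t - t0) powr (s - real (Suc m))) (at t)"
      using \<open>t0 < t\<close> by (auto intro!: derivative_eq_intros simp: algebra_simps)
  qed (use that in auto)
  have *: "(Dt ^^ m) w x t = c * (\<Prod>i<m. s - real i) * (t - t0) powr (s - real m)" if "t0 < t" for t
    using that
  proof (induction m arbitrary: t)
    case (Suc m)
    then show ?case
      unfolding Dt_pow_Suc by (intro DERIV_imp_deriv deriv)
  qed (use w in simp)
  then show "(Dt ^^ m) w x t = c * (\<Prod>i<m. s - real i) * (t - t0) powr (s - real m)"
    using \<open>t0 < t\<close> .
  show "(\<lambda>t. (Dt ^^ m) w x t) differentiable (at t)"
    using deriv[OF * \<open>t0 < t\<close>] real_differentiable_def by blast
qed

lemma Dx_pow_const_in_x: "(Dx ^^ m) (\<lambda>x. g) = (\<lambda>x t. if m = 0 then g t else 0)"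
  by (induction m) (auto simp: Dx_def fun_eq_iff)

text \<open>The constant is K at the list 1, 0, ..., 0.\<close>

lemma space_fun_one: "\<exists>c. space_fun K r (\<lambda>x t. 1) = (\<lambda>x t. c)"
  by (auto simp: space_fun_def Dx_pow_const_in_x simp del: upt_Suc)

lemma one_regular:
  assumes "\<alpha> < real p"
  shows "(\<lambda>x t. 1) \<in> regular a b t0 T p q \<alpha> K r"
proof -
  obtain c where c: "space_fun K r (\<lambda>x t. 1) = (\<lambda>x t. c)"
    using space_fun_one by blast
  have "(\<lambda>s. (Dt ^^ m) (frac_int t0 (real p - \<alpha>) (\<lambda>x t. 1)) x s) differentiable (at t)"
    if "t0 < t" for m x t
    by (rule Dt_pow_shifted_powr(2)[of t0 _ _ "1 / ((real p - \<alpha>) * Gamma (real p - \<alpha>))" "real p - \<alpha>"])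
      (use assms that in \<open>auto simp: frac_int_one\<close>)
  then show ?thesis
    using Abel_kernel_integral(1)[of "real p - \<alpha>" t0] assms
    by (simp add: regular_def c Dx_pow_const_in_x)
qed

text \<open>As q is positive, the space term is a derivative of a constant and vanishes. What
  remains is a power of t - t0 times a falling factorial of the non-integer s.\<close>

lemma PDE_lhs_one_nonzero:
  assumes "q \<ge> 1" "real p - 1 < \<alpha>" "\<alpha> < real p" "t0 < t"
  shows "PDE_lhs t0 p q \<alpha> K r (\<lambda>x t. 1) x t \<noteq> 0"
proof -
  define s where "s = real p - \<alpha>"
  have s: "0 < s" "s < 1"
    using assms by (auto simp: s_def)
  obtain c where c: "space_fun K r (\<lambda>x t. 1) = (\<lambda>x t. c)"
    using space_fun_one by blast
  have "RL_deriv t0 p \<alpha> (\<lambda>x t. 1) x t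
      = 1 / (s * Gamma s) * (\<Prod>i<p. s - real i) * (t - t0) powr (s - real p)"
    unfolding RL_deriv_def s_def[symmetric]
    by (rule Dt_pow_shifted_powr(1)) (use s \<open>t0 < t\<close> in \<open>auto simp: frac_int_one\<close>)
  \<comment> \<open>For i = 0 this is s > 0, for larger i it is s < 1.\<close>
  moreover have "s - real i \<noteq> 0" for i
    using s by (cases i) auto
  moreover have "Gamma s \<noteq> 0"
    using Gamma_real_pos[of s] s by linarith
  ultimately show ?thesis
    using s assms by (simp add: PDE_lhs_def c Dx_pow_const_in_x)
qed

section \<open>Linear independence and conclusion\<close>

lemma polynomial_zero_on_infinite:
  fixes c :: "nat \<Rightarrow> real"
  assumes "infinite X" "\<And>x. x \<in> X \<Longrightarrow> (\<Sum>i<n. c i * x ^ i) = 0" "i < n"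
  shows "c i = 0"
proof (rule ccontr)
  assume "c i \<noteq> 0"
  then have "finite {x. (\<Sum>i\<le>n - 1. c i * x ^ i) = 0}"
    using \<open>i < n\<close> by (subst polyfun_finite_roots) (auto intro!: exI[of _ i])
  moreover have "{..n - 1} = {..<n}"
    using \<open>i < n\<close> by auto
  ultimately show False
    using assms(1,2) finite_subset[of X "{x. (\<Sum>i<n. c i * x ^ i) = 0}"] by auto
qed

text \<open>This makes "at least p q" precise: no nontrivial combination of the laws has a
  divergence that vanishes for all regular u.\<close>

lemma lin_indep_total_div:
  assumes "q \<ge> 1" "real p - 1 < \<alpha>" "\<alpha> < real p" "a < b" "t0 < T"
  shows "lin_indep_ops {a<..<b} {t0<..<T} (regular a b t0 T p q \<alpha> K r) ({..<q} \<times> {..<p})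
            (\<lambda>(k, j). total_div (cl_flux q K r k (\<lambda>t. t ^ j)) (cl_density t0 p \<alpha> k j))"
  unfolding lin_indep_ops_def
proof (intro allI impI ballI)
  fix c :: "nat \<times> nat \<Rightarrow> real" and kj
  assume zero: "\<forall>u\<in>regular a b t0 T p q \<alpha> K r. \<forall>x\<in>{a<..<b}. \<forall>t\<in>{t0<..<T}.
      (\<Sum>i\<in>{..<q} \<times> {..<p}. c i * (case i of (k, j) \<Rightarrow>
        total_div (cl_flux q K r k (\<lambda>t. t ^ j)) (cl_density t0 p \<alpha> k j)) u x t) = 0"
    and "kj \<in> {..<q} \<times> {..<p}"
  then obtain k j where kj: "kj = (k, j)" "k < q" "j < p"
    by auto
  have one: "(\<lambda>x t. 1) \<in> regular a b t0 T p q \<alpha> K r"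
    using one_regular \<open>\<alpha> < real p\<close> .
  \<comment> \<open>The combination at u = 1, divided by the nonzero value of the equation and
    ordered by powers of x.\<close>
  have "(\<Sum>k<q. (\<Sum>j<p. c (k, j) * t ^ j) * x ^ k) = 0"
    if x: "x \<in> {a<..<b}" and t: "t \<in> {t0<..<T}" for x t
  proof -
    let ?E = "PDE_lhs t0 p q \<alpha> K r (\<lambda>x t. 1) x t"
    have "0 = (\<Sum>i\<in>{..<q} \<times> {..<p}. c i * (case i of (k, j) \<Rightarrow>
        total_div (cl_flux q K r k (\<lambda>t. t ^ j)) (cl_density t0 p \<alpha> k j)) (\<lambda>x t. 1) x t)"
      using zero one x t by simp
    also have "\<dots> = (\<Sum>(k, j)\<in>{..<q} \<times> {..<p}. c (k, j) * (x ^ k * t ^ j * ?E))"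
      by (rule sum.cong) (auto simp: total_div_eq[OF one _ _ x t])
    also have "\<dots> = (\<Sum>k<q. (\<Sum>j<p. c (k, j) * t ^ j) * x ^ k) * ?E"
      by (simp add: sum.cartesian_product[symmetric] sum_distrib_left sum_distrib_right mult_ac)
    finally show ?thesis
      using PDE_lhs_one_nonzero[OF assms(1-3)] t by simp
  qed
  \<comment> \<open>Coefficients are compared first in x at fixed t, then in t.\<close>
  then have "(\<Sum>j<p. c (k, j) * t ^ j) = 0" if "t \<in> {t0<..<T}" for t
    using polynomial_zero_on_infinite[where X = "{a<..<b}" and n = q and c = "\<lambda>k. \<Sum>j<p. c (k, j) * t ^ j"]
      that kj \<open>a < b\<close> by auto
  then show "c kj = 0"
    using polynomial_zero_on_infinite[where X = "{t0<..<T}" and n = p and c = "\<lambda>j. c (k, j)"] kj \<open>t0 < T\<close> by auto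
qed

theorem corollary1:
  fixes p q r :: nat and \<alpha> a b t0 T :: real and K :: "real list \<Rightarrow> real"
  assumes "p \<ge> 1" and "q \<ge> 1"
    and "real p - 1 < \<alpha>" and "\<alpha> < real p"
    and "a < b" and "t0 < T"
  shows "(\<forall>k<q. \<forall>j<p.
            conservation_law {a<..<b} {t0<..<T} t0 (real p - \<alpha>)
              (regular a b t0 T p q \<alpha> K r) (PDE_lhs t0 p q \<alpha> K r)
              (cl_flux q K r k (\<lambda>t. t ^ j)) (cl_density t0 p \<alpha> k j)) \<and>
         lin_indep_ops {a<..<b} {t0<..<T} (regular a b t0 T p q \<alpha> K r) ({..<q} \<times> {..<p})
            (\<lambda>(k, j). total_div (cl_flux q K r k (\<lambda>t. t ^ j)) (cl_density t0 p \<alpha> k j))"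
proof (intro conjI allI impI)
  fix k j assume "k < q" "j < p"
  \<comment> \<open>\<open>deriv\<close> has a value even where no derivative exists, so
    differentiability is a separate clause of a conservation law.\<close>
  have "(\<lambda>y. cl_flux q K r k (\<lambda>t. t ^ j) u y t) differentiable (at x)"
    "(\<lambda>s. cl_density t0 p \<alpha> k j u x s) differentiable (at t)"
    if "u \<in> regular a b t0 T p q \<alpha> K r" "x \<in> {a<..<b}" "t \<in> {t0<..<T}" for u x t
    using cl_flux_derivative[OF that(1) \<open>k < q\<close> that(2,3)]
      cl_density_derivative[OF that(1) \<open>j < p\<close> that(2,3)] real_differentiable_def by blast+
  then show "conservation_law {a<..<b} {t0<..<T} t0 (real p - \<alpha>)
      (regular a b t0 T p q \<alpha> K r) (PDE_lhs t0 p q \<alpha> K r)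
      (cl_flux q K r k (\<lambda>t. t ^ j)) (cl_density t0 p \<alpha> k j)"
    unfolding conservation_law_def
    using frac_diff_fun_cl_flux frac_diff_fun_cl_density \<open>k < q\<close> \<open>j < p\<close>
    by (auto simp: total_div_eq)
next
  show "lin_indep_ops {a<..<b} {t0<..<T} (regular a b t0 T p q \<alpha> K r) ({..<q} \<times> {..<p})
      (\<lambda>(k, j). total_div (cl_flux q K r k (\<lambda>t. t ^ j)) (cl_density t0 p \<alpha> k j))"
    using assms by (intro lin_indep_total_div)
qed

end
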